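(* Let $G$ be a finite subgroup of $\mathrm{O}(2)$. If $G$ has SCP, then $G$ has LCP; that is, if there exists $w\in \mathrm{Diff}(S^1)\setminus \mathrm{Diff}^{+}(S^1)$ with $w^{-1}gw=g$ for all $g\in G$, then there exists $w'\in \mathrm{O}(2)\setminus \mathrm{SO}(2)$ with $w'^{-1}gw'=g$ for all $g\in G$.
   Context: $\mathrm{O}(2)$ is regarded as a subgroup of $\mathrm{Diff}(S^1)$, the diffeomorphism group of the unit circle, via its standard action; $\mathrm{Diff}^{+}(S^1)$ is the subgroup of orientation-preserving diffeomorphisms. LCP (amphichiral linear centralizer property) and SCP (amphichiral smooth centralizer property) are the properties spelled out in the claim. *)

theory Defs
  imports "HOL-Analysis.Analysis" "HOL-Algebra.Bij"
begin

abbreviation circle :: "(real^2) set" where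
  "circle \<equiv> sphere 0 1"

definition circle_point :: "real \<Rightarrow> real^2" where
  "circle_point t = vector [cos t, sin t]"

text \<open>Infinite differentiability: \<open>D n\<close> is the \<open>n\<close>-th derivative of \<open>c\<close>.\<close>

definition smooth_curve :: "(real \<Rightarrow> real^2) \<Rightarrow> bool" where
  "smooth_curve c \<longleftrightarrow>
     (\<exists>D :: nat \<Rightarrow> real \<Rightarrow> real^2. D 0 = c \<and>
        (\<forall>n t. (D n has_vector_derivative D (Suc n) t) (at t)))"

text \<open>The charts of the circle are the local inverses of \<^term>\<open>circle_point\<close>, and the circle is an
  embedded submanifold of the plane. So a self-map of the circle is smooth iff its expression in
  the angular coordinate of the domain is smooth as a map into the plane.\<close>

definition smooth_circle_map :: "(real^2 \<Rightarrow> real^2) \<Rightarrow> bool" where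
  "smooth_circle_map f \<longleftrightarrow> f ` circle \<subseteq> circle \<and> smooth_curve (\<lambda>t. f (circle_point t))"

text \<open>Self-maps of the circle are represented by extensional functions (undefined off the circle),
  so that they are elements of the group \<^term>\<open>BijGroup circle\<close> of all bijections, under
  composition; all the groups below carry its operations.\<close>

definition Diff_circle :: "(real^2 \<Rightarrow> real^2) set" where
  "Diff_circle =
     {f \<in> Bij circle. smooth_circle_map f \<and> smooth_circle_map (inv_into circle f)}"

text \<open>A vector \<open>v\<close> tangent to the circle at \<open>p\<close> points counterclockwise iff the pair \<open>(p, v)\<close> has
  positive determinant. The velocity of \<^term>\<open>circle_point\<close> points counterclockwise, and so
  must its image under the differential of \<open>f\<close>.\<close>

definition orientation_preserving :: "(real^2 \<Rightarrow> real^2) \<Rightarrow> bool" where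
  "orientation_preserving f \<longleftrightarrow>
     (\<forall>t. let p = f (circle_point t);
              v = vector_derivative (\<lambda>s. f (circle_point s)) (at t)
          in p $ 1 * v $ 2 - p $ 2 * v $ 1 > 0)"

definition Diff_plus_circle :: "(real^2 \<Rightarrow> real^2) set" where
  "Diff_plus_circle = {f \<in> Diff_circle. orientation_preserving f}"

definition circle_action :: "real^2^2 \<Rightarrow> real^2 \<Rightarrow> real^2" where
  "circle_action A = restrict ((*v) A) circle"

definition O2 :: "(real^2 \<Rightarrow> real^2) set" where
  "O2 = circle_action ` {A. orthogonal_matrix A}"

definition SO2 :: "(real^2 \<Rightarrow> real^2) set" where
  "SO2 = circle_action ` {A. orthogonal_matrix A \<and> det A = 1}"

definition O2_group :: "(real^2 \<Rightarrow> real^2) monoid" where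
  "O2_group = BijGroup circle\<lparr>carrier := O2\<rparr>"

definition conjugation_fixes ::
    "(real^2 \<Rightarrow> real^2) \<Rightarrow> (real^2 \<Rightarrow> real^2) set \<Rightarrow> bool" where
  "conjugation_fixes w G \<longleftrightarrow>
     (\<forall>g\<in>G. inv\<^bsub>BijGroup circle\<^esub> w \<otimes>\<^bsub>BijGroup circle\<^esub> g \<otimes>\<^bsub>BijGroup circle\<^esub> w = g)"

definition has_SCP :: "(real^2 \<Rightarrow> real^2) set \<Rightarrow> bool" where
  "has_SCP G \<longleftrightarrow> (\<exists>w \<in> Diff_circle - Diff_plus_circle. conjugation_fixes w G)"

definition has_LCP :: "(real^2 \<Rightarrow> real^2) set \<Rightarrow> bool" where
  "has_LCP G \<longleftrightarrow> (\<exists>w \<in> O2 - SO2. conjugation_fixes w G)"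


lemma norm_orthogonal_matrix:
  assumes "orthogonal_matrix (A :: real^2^2)"
  shows "norm (A *v x) = norm x"
  using assms by (metis orthogonal_transformation_matrix orthogonal_transformation_norm
      matrix_of_matrix_vector_mul matrix_vector_mul_linear)

lemma orthogonal_matrix_cancel:
  assumes "orthogonal_matrix (A :: real^2^2)"
  shows "transpose A *v (A *v x) = x" "A *v (transpose A *v x) = x"
  using assms by (simp_all only: orthogonal_matrix_def matrix_vector_mul_assoc matrix_vector_mul_lid)

lemma circle_action_Bij:
  assumes A: "orthogonal_matrix A"
  shows "circle_action A \<in> Bij circle"
proof -
  have "bij_betw (circle_action A) circle circle"
  proof (rule bij_betw_byWitness[where f' = "\<lambda>x. transpose A *v x"])
    show "(\<lambda>x. transpose A *v x) ` circle \<subseteq> circle"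
      using norm_orthogonal_matrix[of "transpose A"] A by auto
  qed (auto simp: circle_action_def orthogonal_matrix_cancel norm_orthogonal_matrix A
      simp del: transpose_matrix_vector)
  then show ?thesis
    by (simp add: Bij_def circle_action_def)
qed

lemma circle_action_mult:
  assumes "orthogonal_matrix A" "orthogonal_matrix B"
  shows "circle_action A \<otimes>\<^bsub>BijGroup circle\<^esub> circle_action B = circle_action (A ** B)"
  using assms circle_action_Bij[of A] circle_action_Bij[of B]
  by (auto simp: BijGroup_def compose_def circle_action_def norm_orthogonal_matrix
      matrix_vector_mul_assoc fun_eq_iff)

lemma circle_action_one: "circle_action (mat 1) = \<one>\<^bsub>BijGroup circle\<^esub>"
  by (auto simp: BijGroup_def circle_action_def)

lemma circle_action_inv:
  assumes A: "orthogonal_matrix A"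
  shows "inv\<^bsub>BijGroup circle\<^esub> (circle_action A) = circle_action (transpose A)"
proof (rule group.inv_equality[OF group_BijGroup])
  show "circle_action (transpose A) \<otimes>\<^bsub>BijGroup circle\<^esub> circle_action A = \<one>\<^bsub>BijGroup circle\<^esub>"
    using A circle_action_mult[of "transpose A" A]
    by (simp add: circle_action_one orthogonal_matrix_def)
qed (use A circle_action_Bij in \<open>auto simp: BijGroup_def\<close>)

lemma subgroup_O2: "subgroup O2 (BijGroup circle)"
proof (rule group.subgroupI[OF group_BijGroup])
  show "O2 \<subseteq> carrier (BijGroup circle)"
    using circle_action_Bij by (auto simp: O2_def BijGroup_def)
  show "O2 \<noteq> {}"
    using orthogonal_matrix_id by (auto simp: O2_def)
qed (auto simp: O2_def circle_action_inv circle_action_mult intro!: orthogonal_matrix_mul)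

lemma group_O2_group: "group O2_group"
  unfolding O2_group_def
  by (rule subgroup.subgroup_is_group[OF subgroup_O2 group_BijGroup])

lemma circle_point_in_circle: "circle_point t \<in> circle"
  by (simp add: circle_point_def norm_vec_def L2_set_def UNIV_2)

lemma smooth_curve_circle_point: "smooth_curve circle_point"
proof -
  have "((\<lambda>t. circle_point (t + real n * (pi/2))) has_vector_derivative
          circle_point (t + real (Suc n) * (pi/2))) (at t)" for n t
  proof -
    have eq: "circle_point s = cos s *\<^sub>R axis 1 1 + sin s *\<^sub>R axis 2 1" for s
      by (simp add: circle_point_def vec_eq_iff forall_2 axis_def)
    have "((\<lambda>t. circle_point (t + a)) has_vector_derivative circle_point (t + a + pi/2)) (at t)" for a
      unfolding eq
      by (auto simp: cos_add sin_add intro!: derivative_eq_intros)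
    from this[of "real n * (pi/2)"] show ?thesis
      by (simp add: algebra_simps add_divide_distrib)
  qed
  then show ?thesis
    unfolding smooth_curve_def
    by (intro exI[of _ "\<lambda>n t. circle_point (t + real n * (pi/2))"]) auto
qed

lemma smooth_circle_map_orthogonal:
  assumes A: "orthogonal_matrix A"
    and f: "\<And>x. x \<in> circle \<Longrightarrow> f x = A *v x"
  shows "smooth_circle_map f"
proof -
  obtain D where D: "D 0 = circle_point"
      "\<And>n t. (D n has_vector_derivative D (Suc n) t) (at t)"
    using smooth_curve_circle_point unfolding smooth_curve_def by blast
  have "((\<lambda>t. A *v D n t) has_vector_derivative A *v D (Suc n) t) (at t)" for n t
    by (rule bounded_linear.has_vector_derivative[OF matrix_vector_mul_bounded_linear D(2)])
  then have "smooth_curve (\<lambda>t. A *v circle_point t)"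
    unfolding smooth_curve_def using D(1) by (intro exI[of _ "\<lambda>n t. A *v D n t"]) auto
  then show ?thesis
    using f A circle_point_in_circle
    by (auto simp: smooth_circle_map_def norm_orthogonal_matrix)
qed

lemma O2_subset_Diff_circle: "O2 \<subseteq> Diff_circle"
proof
  fix f assume "f \<in> O2"
  then obtain A where A: "orthogonal_matrix A" "f = circle_action A"
    by (auto simp: O2_def)
  have f: "f \<in> Bij circle"
    using A circle_action_Bij by simp
  have "inv_into circle f x = transpose A *v x" if "x \<in> circle" for x
  proof (rule inv_into_f_eq)
    show "inj_on f circle"
      using f by (auto simp: Bij_def bij_betw_def)
  qed (use that A norm_orthogonal_matrix[of "transpose A"]
        in \<open>auto simp: circle_action_def orthogonal_matrix_cancel
          simp del: transpose_matrix_vector\<close>)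
  then have "smooth_circle_map (inv_into circle f)"
    using A by (intro smooth_circle_map_orthogonal[of "transpose A"]) auto
  moreover have "smooth_circle_map f"
    using A by (intro smooth_circle_map_orthogonal[of A]) (auto simp: circle_action_def)
  ultimately show "f \<in> Diff_circle"
    using f by (simp add: Diff_circle_def)
qed

end

theory Submission
  imports Defs
begin

text \<open>A smooth circle map lifts along \<^term>\<open>circle_point\<close> to a real function \<open>W\<close> with
  \<open>W (t + 2\<pi>) = W t + 2\<pi>d\<close>. For a diffeomorphism, lifting the inverse as well gives \<open>d = \<plusminus>1\<close>,
  and \<open>d = -1\<close> in the orientation-reversing case. If the diffeomorphism commutes with the rotation
  by \<open>a\<close>, then \<open>W (t + a) = W t + a + 2\<pi>k\<close>, so the periodic function \<open>h t = W t + t\<close> satisfies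
  \<open>h (t + a) = h t + 2a + 2\<pi>k\<close>. As \<open>h\<close> is bounded and attains its bounds, \<open>2a + 2\<pi>k = 0\<close>, and the
  rotation is \<open>\<plusminus>1\<close>. Hence a group with SCP contains no rotations besides \<open>\<plusminus>1\<close>. Then any two
  reflections in it agree up to sign, so a reflection in the group (or any reflection at all, if
  there is none) centralizes the group.\<close>

section \<open>The angular parametrization of the circle\<close>

lemma circle_point_nth [simp]: "circle_point t $ 1 = cos t" "circle_point t $ 2 = sin t"
  by (simp_all add: circle_point_def)

lemma circle_point_eq_iff:
  "circle_point s = circle_point t \<longleftrightarrow> (\<exists>k::int. s = t + 2 * pi * k)"
  by (simp add: vec_eq_iff forall_2 sin_cos_eq_iff[symmetric] conj_commute)

lemma circle_pointE:
  assumes "x \<in> circle"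
  obtains t where "x = circle_point t"
proof -
  have "(x $ 1)\<^sup>2 + (x $ 2)\<^sup>2 = 1"
    using assms by (simp add: norm_vec_def L2_set_def sum_2)
  then obtain t where "x $ 1 = cos t" "x $ 2 = sin t"
    by (metis sincos_total_2pi)
  then show thesis
    by (intro that[of t]) (simp add: vec_eq_iff forall_2)
qed

section \<open>Lifts of circle maps\<close>

text \<open>The difference divided by \<open>2 * pi\<close> is continuous and integer-valued.
  Distinct integers lie at distance at least 1, so on the connected line it is constant.\<close>

lemma lifts_differ_by_period:
  fixes A B :: "real \<Rightarrow> real"
  assumes "continuous_on UNIV A" "continuous_on UNIV B"
    and eq: "\<And>t. circle_point (A t) = circle_point (B t)"
  obtains k :: int where "\<And>t. A t = B t + 2 * pi * k"
proof -
  define h where "h t = (A t - B t) / (2 * pi)" for t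
  have h_int: "h t \<in> \<int>" for t
    using eq[of t] by (auto simp: circle_point_eq_iff h_def)
  have "h constant_on UNIV"
  proof (rule continuous_discrete_range_constant)
    show "continuous_on UNIV h"
      unfolding h_def using assms by (intro continuous_intros) auto
    show "\<exists>e>0. \<forall>y. y \<in> UNIV \<and> h y \<noteq> h x \<longrightarrow> e \<le> norm (h y - h x)" for x
      using h_int by (intro exI[of _ 1]) (auto intro!: Ints_nonzero_abs_ge1)
  qed auto
  then obtain c where c: "\<And>t. h t = c"
    by (auto simp: constant_on_def)
  with h_int obtain k :: int where "c = k"
    by (metis Ints_cases)
  with c have "A t = B t + 2 * pi * k" for t
    using c[of t] by (simp add: h_def field_simps)
  then show thesis
    by (rule that)
qed

text \<open>The angle is obtained by integrating the angular velocity. Its derivative is therefore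
  known at once, and it is the determinant that \<open>orientation_preserving\<close> tests.\<close>

lemma unit_curve_angle:
  fixes c :: "real \<Rightarrow> real^2"
  assumes "smooth_curve c" and c_circle: "\<And>t. c t \<in> circle"
  obtains W where "\<And>t. c t = circle_point (W t)"
    "\<And>t. (W has_real_derivative
        c t $ 1 * vector_derivative c (at t) $ 2 - c t $ 2 * vector_derivative c (at t) $ 1) (at t)"
proof -
  obtain D where D0: "D 0 = c"
    and D: "\<And>n t. (D n has_vector_derivative D (Suc n) t) (at t)"
    using assms(1) unfolding smooth_curve_def by blast
  have D_nth: "((\<lambda>t. D n t $ i) has_real_derivative D (Suc n) t $ i) (at t)" for n t i
    using bounded_linear.has_vector_derivative[OF bounded_linear_vec_nth D]
    by (simp add: has_real_derivative_iff_has_vector_derivative)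
  define x y x' y' where defs: "x = (\<lambda>t. c t $ 1)" "y = (\<lambda>t. c t $ 2)"
    "x' = (\<lambda>t. D 1 t $ 1)" "y' = (\<lambda>t. D 1 t $ 2)"
  define w where "w t = x t * y' t - y t * x' t" for t
  have dx: "(x has_real_derivative x' t) (at t)" and dy: "(y has_real_derivative y' t) (at t)" for t
    using D_nth[of 0] by (simp_all add: defs D0)
  have unit: "x t * x t + y t * y t = 1" for t
    using c_circle[of t] by (simp add: norm_vec_def L2_set_def sum_2 defs power2_eq_square)
  have tangent: "x t * x' t + y t * y' t = 0" for t
  proof -
    have "((\<lambda>t. x t * x t + y t * y t) has_real_derivative 2 * (x t * x' t + y t * y' t)) (at t)"
      by (rule derivative_eq_intros dx dy refl | simp)+
    moreover have "((\<lambda>t. x t * x t + y t * y t) has_real_derivative 0) (at t)"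
      by (simp add: unit)
    ultimately show ?thesis
      using DERIV_unique by fastforce
  qed
  \<comment> \<open>The velocity is orthogonal to the unit vector \<open>(x, y)\<close>, so it is
    \<open>w\<close> times the quarter turn \<open>(-y, x)\<close>.\<close>
  have x': "x' t = - (w t * y t)" for t
  proof -
    have "- (w t * y t) = (x t * x t + y t * y t) * x' t - x t * (x t * x' t + y t * y' t)"
      by (simp add: w_def algebra_simps)
    then show ?thesis
      by (simp add: unit tangent)
  qed
  have y': "y' t = w t * x t" for t
  proof -
    have "w t * x t = (x t * x t + y t * y t) * y' t - y t * (x t * x' t + y t * y' t)"
      by (simp add: w_def algebra_simps)
    then show ?thesis
      by (simp add: unit tangent)
  qed
  have "isCont w t" for t
    unfolding w_def defs
    using has_vector_derivative_continuous[OF D[of 0 t]] has_vector_derivative_continuous[OF D[of 1 t]]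
    by (intro continuous_intros) (auto simp: D0)
  then obtain F where F: "\<And>t. (F has_real_derivative w t) (at t)"
    using einterval_antiderivative[of "-\<infinity>" "\<infinity>" w]
    by (auto simp: has_real_derivative_iff_has_vector_derivative)
  obtain t0 where t0: "c 0 = circle_point t0"
    using circle_pointE[OF c_circle] .
  \<comment> \<open>The constants give \<open>W 0 = t0\<close>, so that the curve and
    \<open>circle_point (W t)\<close> start at the same point.\<close>
  define W where "W t = F t - F 0 + t0" for t
  have W: "(W has_real_derivative w t) (at t)" for t
    unfolding W_def by (rule derivative_eq_intros F refl | simp)+
  \<comment> \<open>This is the inner product of \<open>c t\<close> and
    \<open>circle_point (W t)\<close>. It is constant, and it equals 1 at 0. Unit vectors with inner
    product 1 coincide, since their squared distance is 2 minus twice that product.\<close>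
  have "((\<lambda>t. x t * cos (W t) + y t * sin (W t)) has_real_derivative 0) (at t)" for t
    by (rule derivative_eq_intros dx dy W refl | simp add: x' y' algebra_simps)+
  then have "x t * cos (W t) + y t * sin (W t) = x 0 * cos (W 0) + y 0 * sin (W 0)" for t
    using DERIV_isconst_all by blast
  then have one: "x t * cos (W t) + y t * sin (W t) = 1" for t
    using t0 sin_cos_squared_add[of t0] by (simp add: W_def defs power2_eq_square)
  have "x t = cos (W t) \<and> y t = sin (W t)" for t
  proof -
    have "(x t - cos (W t))\<^sup>2 + (y t - sin (W t))\<^sup>2 = 0"
      using one[of t] unit[of t] sin_cos_squared_add[of "W t"]
      by (simp add: power2_eq_square algebra_simps)
    then show ?thesis
      by (simp add: sum_power2_eq_zero_iff)
  qed
  then have "c t = circle_point (W t)" for t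
    by (simp add: vec_eq_iff forall_2 defs)
  moreover have "vector_derivative c (at t) = D 1 t" for t
    using D[of 0 t] by (simp add: D0 vector_derivative_at)
  ultimately show thesis
    using W by (intro that[of W]) (auto simp: w_def defs)
qed

lemma degree_int_periods:
  fixes W :: "real \<Rightarrow> real"
  assumes "\<And>t. W (t + 2 * pi) = W t + 2 * pi * d"
  shows "W (t + 2 * pi * of_int n) = W t + 2 * pi * d * of_int n"
proof (induction n arbitrary: t rule: int_induct[where k = 0])
  case (step1 i)
  then show ?case
    using assms[of "t + 2 * pi * of_int i"] by (simp add: algebra_simps)
next
  case (step2 i)
  then show ?case
    using assms[of "t + 2 * pi * of_int (i - 1)"] by (simp add: algebra_simps)
qed simp

text \<open>The integer \<open>d\<close> is the degree of \<open>f\<close>: \<open>W\<close> and its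
  shift by one turn lift the same curve, so they differ by a constant multiple of
  \<open>2 * pi\<close>.\<close>

lemma smooth_circle_map_lift:
  assumes "smooth_circle_map f"
  obtains W and d :: int where "\<And>t. f (circle_point t) = circle_point (W t)"
    "\<And>t. (W has_real_derivative
        (let p = f (circle_point t);
             v = vector_derivative (\<lambda>s. f (circle_point s)) (at t)
         in p $ 1 * v $ 2 - p $ 2 * v $ 1)) (at t)"
    "\<And>t n. W (t + 2 * pi * of_int n) = W t + 2 * pi * d * of_int n"
proof -
  have "smooth_curve (\<lambda>t. f (circle_point t))" "\<And>t. f (circle_point t) \<in> circle"
    using assms circle_point_in_circle by (auto simp: smooth_circle_map_def image_subset_iff)
  from unit_curve_angle[OF this] obtain W where W: "\<And>t. f (circle_point t) = circle_point (W t)"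
    "\<And>t. (W has_real_derivative
        f (circle_point t) $ 1 * vector_derivative (\<lambda>s. f (circle_point s)) (at t) $ 2
        - f (circle_point t) $ 2 * vector_derivative (\<lambda>s. f (circle_point s)) (at t) $ 1) (at t)"
    by blast
  have cont: "continuous_on UNIV W"
    by (rule DERIV_continuous_on) (rule has_field_derivative_at_within[OF W(2)])
  have "circle_point (t + 2 * pi) = circle_point t" for t
    by (simp add: vec_eq_iff forall_2)
  then have "circle_point (W (t + 2 * pi)) = circle_point (W t)" for t
    by (simp flip: W(1))
  moreover have "continuous_on UNIV (\<lambda>t. W (t + 2 * pi))"
    by (rule continuous_on_compose2[OF cont] continuous_intros | simp)+
  ultimately obtain d :: int where d: "\<And>t. W (t + 2 * pi) = W t + 2 * pi * d"
    using lifts_differ_by_period[OF _ cont] by blast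
  show thesis
    using W by (intro that[of W d] degree_int_periods d) (simp_all add: Let_def)
qed

lemma Diff_circle_reversing_lift:
  assumes "w \<in> Diff_circle - Diff_plus_circle"
  obtains W where "\<And>t. w (circle_point t) = circle_point (W t)" "continuous_on UNIV W"
    "\<And>t n. W (t + 2 * pi * of_int n) = W t - 2 * pi * of_int n"
proof -
  have bij: "bij_betw w circle circle" and smooth: "smooth_circle_map w"
    and smooth': "smooth_circle_map (inv_into circle w)" and rev: "\<not> orientation_preserving w"
    using assms by (auto simp: Diff_circle_def Diff_plus_circle_def Bij_def)
  define om where "om t = (let p = w (circle_point t);
      v = vector_derivative (\<lambda>s. w (circle_point s)) (at t) in p $ 1 * v $ 2 - p $ 2 * v $ 1)" for t
  obtain W and d :: int where W: "\<And>t. w (circle_point t) = circle_point (W t)"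
    and dW: "\<And>t. (W has_real_derivative om t) (at t)"
    and d: "\<And>t n. W (t + 2 * pi * of_int n) = W t + 2 * pi * d * of_int n"
    by (rule smooth_circle_map_lift[OF smooth, folded om_def], rule that)
  obtain V v and e :: int
    where V: "\<And>t. inv_into circle w (circle_point t) = circle_point (V t)"
    and dV: "\<And>t. (V has_real_derivative v t) (at t)"
    and e: "\<And>t n. V (t + 2 * pi * of_int n) = V t + 2 * pi * e * of_int n"
    by (rule smooth_circle_map_lift[OF smooth'], rule that)
  have cont: "continuous_on UNIV W" "continuous_on UNIV V"
    by (rule DERIV_continuous_on, rule has_field_derivative_at_within, rule dW dV)+
  \<comment> \<open>\<open>V\<close> after \<open>W\<close> lifts the identity, as does the identity
    of the line; hence it is a translation.\<close>
  have "circle_point (V (W t)) = circle_point t" for t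
    using V[of "W t"] W[of t] bij_betw_inv_into_left[OF bij circle_point_in_circle[of t]] by simp
  moreover have "continuous_on UNIV (\<lambda>t. V (W t))"
    by (rule continuous_on_compose2[OF cont(2) cont(1)]) simp
  ultimately obtain k :: int where k: "\<And>t. V (W t) = t + 2 * pi * k"
    using lifts_differ_by_period[OF _ continuous_on_id] by blast
  \<comment> \<open>From 0 to \<open>2 * pi\<close>, the composite \<open>V (W t)\<close> grows by
    \<open>2 * pi * (e * d)\<close> according to the degrees, and by \<open>2 * pi\<close> as a
    translation.\<close>
  have "e * d = 1"
  proof -
    have "W (2 * pi) = W 0 + 2 * pi * of_int d"
      using d[of 0 1] by simp
    moreover have "V (W 0 + 2 * pi * of_int d) = V (W 0) + 2 * pi * (e * d)"
      using e[of "W 0" d] by (simp add: mult.assoc)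
    ultimately have "2 * pi * real_of_int (e * d) = 2 * pi * 1"
      using k[of 0] k[of "2 * pi"] by simp
    then have "real_of_int (e * d) = 1"
      by (simp only: mult_cancel_left) simp
    then show ?thesis
      by linarith
  qed
  then have "d = 1 \<or> d = -1"
    by (simp add: zmult_eq_1_iff) blast
  moreover have "d \<noteq> 1"
  proof
    assume "d = 1"
    \<comment> \<open>A continuous injective real function is strictly monotone, and degree 1
      excludes a decreasing one. So \<open>W\<close> increases.\<close>
    have "inj W"
    proof (rule injI)
      fix s t assume "W s = W t"
      then have "V (W s) = V (W t)"
        by (rule arg_cong)
      then show "s = t"
        unfolding k by simp
    qed
    then have "strict_mono W \<or> strict_antimono_on UNIV W"
      using injective_eq_monotone_map[OF _ cont(1)] by simp
    moreover have "W 0 < W (2 * pi)"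
      using d[of 0 1] \<open>d = 1\<close> by simp
    then have "\<not> strict_antimono_on UNIV W"
      using monotone_onD[of UNIV "(<)" "(>)" W 0 "2 * pi"] by auto
    ultimately have mono: "mono_on UNIV W"
      using strict_mono_on_imp_mono_on by auto
    \<comment> \<open>Monotonicity gives only \<open>om t \<ge> 0\<close>; the chain rule for the
      translation \<open>V (W t)\<close> excludes 0. This contradicts \<open>rev\<close>.\<close>
    have "om t > 0" for t
    proof -
      have "((\<lambda>t. V (W t)) has_real_derivative v (W t) * om t) (at t)"
        using DERIV_chain2[OF dV dW] .
      moreover have "((\<lambda>t. V (W t)) has_real_derivative 1) (at t)"
        unfolding k by (rule derivative_eq_intros refl | simp)+
      ultimately have "v (W t) * om t = 1"
        by (rule DERIV_unique)
      moreover have "om t \<ge> 0"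
        using mono_on_imp_deriv_nonneg[OF mono dW] by simp
      ultimately show ?thesis
        by (cases "om t = 0") auto
    qed
    with rev show False
      by (simp add: orientation_preserving_def om_def Let_def)
  qed
  ultimately show thesis
    using W cont(1) d by (intro that[of W]) auto
qed

section \<open>Rotations in the group\<close>

text \<open>Periodicity makes the extrema on \<open>{0..2*pi}\<close> global. Shifting a maximum
  point by \<open>a\<close> cannot raise \<open>h\<close>, so \<open>c \<le> 0\<close>; shifting a
  minimum point cannot lower it, so \<open>c \<ge> 0\<close>.\<close>

lemma periodic_translation_increment_eq_0:
  fixes h :: "real \<Rightarrow> real"
  assumes cont: "continuous_on UNIV h"
    and per: "\<And>t n. h (t + 2 * pi * of_int n) = h t"
    and step: "\<And>t. h (t + a) = h t + c"
  shows "c = 0"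
proof -
  have range: "\<exists>s\<in>{0..2*pi}. h s = h t" for t
  proof
    define n where "n = \<lfloor>t / (2 * pi)\<rfloor>"
    have "of_int n \<le> t / (2 * pi)" "t / (2 * pi) \<le> of_int n + 1"
      unfolding n_def by linarith+
    then show "t - 2 * pi * of_int n \<in> {0..2 * pi}"
      by (simp add: field_simps)
    show "h (t - 2 * pi * of_int n) = h t"
      using per[of "t - 2 * pi * of_int n" n] by simp
  qed
  have cont': "continuous_on {0..2*pi} h"
    using cont continuous_on_subset by blast
  have ne: "{0..2*pi} \<noteq> {}"
    by simp
  obtain M where "\<And>s. s \<in> {0..2*pi} \<Longrightarrow> h s \<le> h M"
    using continuous_attains_sup[OF compact_Icc ne cont'] by blast
  then have "h (M + a) \<le> h M"
    by (metis range)
  moreover obtain m where "\<And>s. s \<in> {0..2*pi} \<Longrightarrow> h m \<le> h s"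
    using continuous_attains_inf[OF compact_Icc ne cont'] by blast
  then have "h m \<le> h (m + a)"
    by (metis range)
  ultimately show "c = 0"
    by (simp add: step)
qed

lemma orthogonal_matrix_det_1_2:
  fixes A :: "real^2^2"
  assumes "orthogonal_matrix A" "det A = 1"
  obtains a where "A = vector [vector [cos a, - sin a], vector [sin a, cos a]]"
proof -
  have "A *v circle_point 0 \<in> circle"
    using circle_point_in_circle[of 0] by (simp add: norm_orthogonal_matrix[OF assms(1)])
  then obtain a where a: "A *v circle_point 0 = circle_point a"
    by (rule circle_pointE)
  have col1: "A $ 1 $ 1 = cos a" "A $ 2 $ 1 = sin a"
    using arg_cong[OF a, of "\<lambda>v. v $ 1"] arg_cong[OF a, of "\<lambda>v. v $ 2"]
    by (simp_all add: matrix_vector_mult_def sum_2)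
  have "transpose A ** A = mat 1"
    using assms(1) by (simp add: orthogonal_matrix_def)
  then have "(transpose A ** A) $ 1 $ 2 = 0"
    by (simp add: mat_def)
  then have "cos a * A $ 1 $ 2 + sin a * A $ 2 $ 2 = 0"
    by (simp add: matrix_matrix_mult_def transpose_def sum_2 col1)
  moreover have "cos a * A $ 2 $ 2 - sin a * A $ 1 $ 2 = 1"
    using assms(2) by (simp add: det_2 col1 mult.commute)
  \<comment> \<open>Orthogonality of the columns and \<open>det A = 1\<close> form a linear system
    for the second column. These identities solve it by Cramer's rule.\<close>
  moreover have "((sin a)\<^sup>2 + (cos a)\<^sup>2) * A $ 1 $ 2
      = cos a * (cos a * A $ 1 $ 2 + sin a * A $ 2 $ 2)
        - sin a * (cos a * A $ 2 $ 2 - sin a * A $ 1 $ 2)"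
    and "((sin a)\<^sup>2 + (cos a)\<^sup>2) * A $ 2 $ 2
      = sin a * (cos a * A $ 1 $ 2 + sin a * A $ 2 $ 2)
        + cos a * (cos a * A $ 2 $ 2 - sin a * A $ 1 $ 2)"
    by algebra+
  ultimately have "A $ 1 $ 2 = - sin a" "A $ 2 $ 2 = cos a"
    by (simp_all only: sin_cos_squared_add)
  with col1 show thesis
    by (intro that[of a]) (simp add: vec_eq_iff forall_2)
qed

text \<open>The conclusion is stated with a scalar matrix because scalar matrices commute with every
  matrix, which is how it is applied below.\<close>

lemma rotation_commuting_reversing:
  fixes A :: "real^2^2"
  assumes A: "orthogonal_matrix A" "det A = 1"
    and w: "w \<in> Diff_circle - Diff_plus_circle"
    and comm: "\<And>x. x \<in> circle \<Longrightarrow> w (A *v x) = A *v w x"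
  shows "\<exists>c. A = mat c"
proof -
  obtain a where a: "A = vector [vector [cos a, - sin a], vector [sin a, cos a]]"
    using orthogonal_matrix_det_1_2[OF A] .
  have rot: "A *v circle_point t = circle_point (t + a)" for t
    by (simp add: a vec_eq_iff forall_2 matrix_vector_mult_def sum_2 cos_add sin_add)
  obtain W where W: "\<And>t. w (circle_point t) = circle_point (W t)"
    and cont: "continuous_on UNIV W"
    and deg: "\<And>t n. W (t + 2 * pi * of_int n) = W t - 2 * pi * of_int n"
    using Diff_circle_reversing_lift[OF w] by blast
  have "circle_point (W (t + a)) = circle_point (W t + a)" for t
    using comm[OF circle_point_in_circle[of t]] by (simp add: W rot)
  moreover have "continuous_on UNIV (\<lambda>t. W (t + a))" "continuous_on UNIV (\<lambda>t. W t + a)"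
    by (rule continuous_on_compose2[OF cont] continuous_intros cont | simp)+
  ultimately obtain k :: int where k: "\<And>t. W (t + a) = W t + a + 2 * pi * k"
    using lifts_differ_by_period[of "\<lambda>t. W (t + a)" "\<lambda>t. W t + a"] by blast
  \<comment> \<open>The summand \<open>t\<close> cancels the degree -1 of \<open>W\<close>, which
    makes the function periodic, but adds another \<open>a\<close> to its increment.\<close>
  have "2 * a + 2 * pi * k = 0"
    by (rule periodic_translation_increment_eq_0[of "\<lambda>t. W t + t" a])
      (auto intro!: continuous_intros cont simp: deg k)
  then have "a = of_int (- k) * pi"
    by (simp add: algebra_simps)
  then have "sin a = 0"
    by (simp only: sin_zero_iff_int2) blast
  then show ?thesis
    by (intro exI[of _ "cos a"]) (simp add: a vec_eq_iff forall_2 mat_def)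
qed

section \<open>Linear centralizers\<close>

text \<open>The standard basis lies on the circle, so restricting to the circle loses no information
  about the matrix.\<close>

lemma circle_action_inject:
  assumes "circle_action A = circle_action B"
  shows "A = B"
proof -
  have "A *v axis i 1 = B *v axis i 1" for i
    using fun_cong[OF assms, of "axis i 1"] by (simp add: circle_action_def norm_axis_1)
  then show ?thesis
    by (simp add: vec_eq_iff column_def matrix_vector_mult_basis)
qed

lemma mat_commute: "mat c ** (S :: real^2^2) = S ** mat c"
  by (simp add: vec_eq_iff forall_2 matrix_matrix_mult_def sum_2 mat_def)

theorem theorem9:
  fixes G :: "(real^2 \<Rightarrow> real^2) set"
  assumes "subgroup G O2_group"
    and "finite G"
    and "has_SCP G"
  shows "has_LCP G"
proof -
  interpret B: group "BijGroup circle"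
    by (rule group_BijGroup)
  have G_O2: "G \<subseteq> O2"
    using subgroup.subset[OF assms(1)] by (simp add: O2_group_def)
  obtain w where w: "w \<in> Diff_circle - Diff_plus_circle" and fixes_w: "conjugation_fixes w G"
    using assms(3) by (auto simp: has_SCP_def)
  have w_Bij: "w \<in> Bij circle"
    using w by (simp add: Diff_circle_def)
  have rotations: "\<exists>c. A = mat c"
    if A: "orthogonal_matrix A" "det A = 1" "circle_action A \<in> G" for A
  proof (rule rotation_commuting_reversing[OF A(1,2) w])
    let ?g = "circle_action A"
    have carr: "w \<in> carrier (BijGroup circle)" "?g \<in> carrier (BijGroup circle)"
      using w_Bij circle_action_Bij[OF A(1)] by (simp_all add: BijGroup_def)
    have "inv\<^bsub>BijGroup circle\<^esub> w \<otimes>\<^bsub>BijGroup circle\<^esub> (?g \<otimes>\<^bsub>BijGroup circle\<^esub> w) = ?g"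
      using bspec[OF fixes_w[unfolded conjugation_fixes_def] A(3)] carr by (simp add: B.m_assoc)
    \<comment> \<open>Multiplying the conjugation identity by \<open>w\<close> on the left turns it
      into commutation.\<close>
    then have "?g \<otimes>\<^bsub>BijGroup circle\<^esub> w = w \<otimes>\<^bsub>BijGroup circle\<^esub> ?g"
      using carr by (metis B.inv_solve_left B.m_closed)
    then have "compose circle ?g w = compose circle w ?g"
      using w_Bij circle_action_Bij[OF A(1)] by (simp add: BijGroup_def)
    then show "w (A *v x) = A *v w x" if "x \<in> circle" for x
    proof -
      have "w x \<in> circle"
        using that w_Bij by (auto simp: Bij_def bij_betw_def)
      with fun_cong[OF \<open>compose circle ?g w = compose circle w ?g\<close>, of x] that show ?thesis
        by (simp add: compose_def circle_action_def)
    qed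
  qed
  have "\<exists>S. orthogonal_matrix S \<and> det S = -1 \<and>
      (\<forall>A. orthogonal_matrix A \<longrightarrow> circle_action A \<in> G \<longrightarrow> A ** S = S ** A)"
  proof (cases "\<exists>S. orthogonal_matrix S \<and> det S = -1 \<and> circle_action S \<in> G")
    case True
    then obtain S where S: "orthogonal_matrix S" "det S = -1" "circle_action S \<in> G"
      by blast
    have "A ** S = S ** A" if A: "orthogonal_matrix A" "circle_action A \<in> G" for A
    proof (cases "det A = 1")
      case True
      then show ?thesis
        using rotations A mat_commute by metis
    next
      case False
      then have "det A = -1"
        using det_orthogonal_matrix[OF A(1)] by blast
      \<comment> \<open>The product of two reflections in \<open>G\<close> is a rotation in
        \<open>G\<close>, hence scalar. So \<open>A\<close> is a scalar multiple of
        \<open>transpose S\<close>, the inverse of \<open>S\<close>, and commutes with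
        \<open>S\<close>.\<close>
      moreover have "circle_action (S ** A) \<in> G"
        using subgroup.m_closed[OF assms(1) S(3) A(2)]
        by (simp add: O2_group_def circle_action_mult S A)
      ultimately obtain c where c: "S ** A = mat c"
        using rotations[of "S ** A"] S A by (auto simp: det_mul orthogonal_matrix_mul)
      have S': "transpose S ** S = mat 1"
        using S(1) by (simp add: orthogonal_matrix_def)
      have "A = transpose S ** (S ** A)"
        by (simp add: matrix_mul_assoc S')
      then have "A ** S = transpose S ** (mat c ** S)"
        by (simp add: c matrix_mul_assoc)
      also have "\<dots> = S ** A"
        by (simp add: mat_commute matrix_mul_assoc S' c)
      finally show ?thesis .
    qed
    with S show ?thesis
      by blast
  next
    case False
    \<comment> \<open>The reflection in the first axis. With no reflections in \<open>G\<close>, all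
      its matrices are scalar.\<close>
    let ?S = "vector [vector [1, 0], vector [0, -1]] :: real^2^2"
    have "orthogonal_matrix ?S"
      by (simp add: orthogonal_matrix vec_eq_iff forall_2 matrix_matrix_mult_def sum_2
          transpose_def mat_def)
    moreover have "det ?S = -1"
      by (simp add: det_2)
    moreover have "A ** ?S = ?S ** A" if "orthogonal_matrix A" "circle_action A \<in> G" for A
      using rotations[OF that(1) _ that(2)] det_orthogonal_matrix[OF that(1)] False that mat_commute
      by metis
    ultimately show ?thesis
      by blast
  qed
  then obtain S where S: "orthogonal_matrix S" "det S = -1"
    and comm: "\<And>A. orthogonal_matrix A \<Longrightarrow> circle_action A \<in> G \<Longrightarrow> A ** S = S ** A"
    by blast
  \<comment> \<open>By injectivity of the action, no matrix of determinant 1 induces the same circle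
    map as \<open>S\<close>.\<close>
  have "circle_action S \<in> O2 - SO2"
    using S circle_action_inject by (fastforce simp: O2_def SO2_def)
  moreover have "conjugation_fixes (circle_action S) G"
    unfolding conjugation_fixes_def
  proof
    fix g assume "g \<in> G"
    then obtain A where A: "orthogonal_matrix A" "g = circle_action A"
      using G_O2 by (auto simp: O2_def)
    have "transpose S ** A ** S = A"
      using comm[of A] A \<open>g \<in> G\<close> S(1)
      by (simp add: matrix_mul_assoc[symmetric]) (simp add: matrix_mul_assoc orthogonal_matrix_def)
    then show "inv\<^bsub>BijGroup circle\<^esub> (circle_action S) \<otimes>\<^bsub>BijGroup circle\<^esub> g
        \<otimes>\<^bsub>BijGroup circle\<^esub> circle_action S = g"
      using S A by (simp add: circle_action_inv circle_action_mult orthogonal_matrix_mul)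
  qed
  ultimately show ?thesis
    unfolding has_LCP_def by blast
qed

end
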